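(* Let $d\ge1$, let $m,\beta,\hbar>0$, let $0<\tau_1<1$, and let $\mathbf{X}_P,\mathbf{X}_R\in\Omega=[0,\infty)\times\mathbb{R}^{d-1}$ and $\mathbf{X}_B\in\partial\Omega=\{0\}\times\mathbb{R}^{d-1}$. Then the heat kernel of the direct paths from $\mathbf{X}_P$ to $\mathbf{X}_R$ equals the heat kernel of the paths which bounce off the boundary and have the same endpoints: $$p_{\mathcal{C}_1,\Omega}(\mathbf{X}_R,1;\mathbf{X}_P,0)=p_{\tilde{\mathcal{C}}_1,\Omega}(\mathbf{X}_R,1;\mathbf{X}_P,0).$$
   Context: A free particle of mass $m$ has the time-rescaled Euclidean action $S[\mathbf{X}]=\frac{m}{2\beta\hbar}\int_0^1\|\dot{\mathbf{X}}(\tau)\|^2d\tau$. Paths are written as a classical (straight-line) part plus a quantum fluctuation. Direct paths (class $\mathcal{C}_1$): the classical part is $(1-\tau)\mathbf{X}_P+\tau\mathbf{X}_R$, the fluctuation $\mathbf{Q}$ vanishes at $\tau=0$ and $\tau=1$, and the path integral over the fluctuations is normalized to $\left(\frac{m}{2\pi\beta\hbar}\right)^{d/2}$. Thus $$p_{\mathcal{C}_1,\Omega}(\mathbf{X}_R,1;\mathbf{X}_P,0)=\left(\frac{m}{2\pi\beta\hbar}\right)^{d/2}e^{-\frac{m}{2\beta\hbar}\|\mathbf{X}_R-\mathbf{X}_P\|^2}.$$ Bouncing paths (class $\tilde{\mathcal{C}}_1$): the path goes from $\mathbf{X}_P$ to the boundary point $\mathbf{X}_B$ during $[0,\tau_1]$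 and from $\mathbf{X}_B$ to $\mathbf{X}_R$ during $[\tau_1,1]$. The classical part is a straight line on each time interval. The fluctuation is $\mathbf{Q}(\tau)+\frac{\tau}{\tau_1}\mathbf{Q}_B$ on $[0,\tau_1]$ and $\mathbf{Q}(\tau)+\frac{1-\tau}{1-\tau_1}\mathbf{Q}_B$ on $[\tau_1,1]$, with $\mathbf{Q}$ vanishing at $0,\tau_1,1$. The path integrals over $\mathbf{Q}$ on the two intervals are normalized to $\left(\frac{m}{2\pi\beta\hbar\tau_1}\right)^{d/2}$ and $\left(\frac{m}{2\pi\beta\hbar(1-\tau_1)}\right)^{d/2}$, and the value $\mathbf{Q}_B$ of the fluctuation at time $\tau_1$ is integrated over $\mathbb{R}^d$. Thus $$p_{\tilde{\mathcal{C}}_1,\Omega}(\mathbf{X}_R,1;\mathbf{X}_P,0)=\left(\frac{m}{2\pi\beta\hbar}\right)^{d}\left(\frac{1}{\tau_1(1-\tau_1)}\right)^{d/2}\int_{\mathbb{R}^d}e^{-\frac{m}{2\beta\hbar}\left(\frac{1}{\tau_1}\|\mathbf{X}_B-\mathbf{X}_P+\mathbf{Q}_B\|^2+\frac{1}{1-\tau_1}\|\mathbf{X}_R-\mathbf{X}_B-\mathbf{Q}_B\|^2\right)}d\mathbf{Q}_B.$$ *)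

theory Defs
  imports "HOL-Analysis.Analysis"
begin

text \<open>
  The space is \<^typ>\<open>real ^ 'n\<close> with \<open>d = CARD('n)\<close>; the coordinate that is constrained to be
  nonnegative carries the label \<open>k\<close>.
\<close>

definition half_space :: "'n::finite \<Rightarrow> (real ^ 'n) set" where
  "half_space k = {x. 0 \<le> x $ k}"

text \<open>
  The weight of a path is \<open>exp (- action)\<close>. The bouncing paths below have no velocity at the
  bouncing time, a null set that does not influence the integral.
\<close>

definition action :: "real \<Rightarrow> real \<Rightarrow> real \<Rightarrow> (real \<Rightarrow> real ^ 'n) \<Rightarrow> real" where
  "action m \<beta> hbar X =
     m / (2 * \<beta> * hbar) * integral {0..1} (\<lambda>\<tau>. (norm (vector_derivative X (at \<tau>)))\<^sup>2)"

definition direct_path :: "real ^ 'n \<Rightarrow> real ^ 'n \<Rightarrow> real \<Rightarrow> real ^ 'n" where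
  "direct_path XP XR \<tau> = (1 - \<tau>) *\<^sub>R XP + \<tau> *\<^sub>R XR"

definition bounce_path ::
  "real \<Rightarrow> real ^ 'n \<Rightarrow> real ^ 'n \<Rightarrow> real ^ 'n \<Rightarrow> real \<Rightarrow> real ^ 'n" where
  "bounce_path \<tau>\<^sub>1 XP XB XR \<tau> =
     (if \<tau> \<le> \<tau>\<^sub>1 then (1 - \<tau> / \<tau>\<^sub>1) *\<^sub>R XP + (\<tau> / \<tau>\<^sub>1) *\<^sub>R XB
      else ((1 - \<tau>) / (1 - \<tau>\<^sub>1)) *\<^sub>R XB + ((\<tau> - \<tau>\<^sub>1) / (1 - \<tau>\<^sub>1)) *\<^sub>R XR)"

definition bounce_fluctuation :: "real \<Rightarrow> real ^ 'n \<Rightarrow> real \<Rightarrow> real ^ 'n" where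
  "bounce_fluctuation \<tau>\<^sub>1 QB \<tau> =
     (if \<tau> \<le> \<tau>\<^sub>1 then (\<tau> / \<tau>\<^sub>1) *\<^sub>R QB else ((1 - \<tau>) / (1 - \<tau>\<^sub>1)) *\<^sub>R QB)"

text \<open>
  Path integral over the fluctuations that vanish at both ends of a time interval of length \<open>s\<close>,
  with its value fixed by normalization. Such fluctuations have no cross term in the
  action with a path that is straight on the interval, so this integral is a factor of the kernel.
\<close>

definition fluctuation_factor :: "'n::finite itself \<Rightarrow> real \<Rightarrow> real \<Rightarrow> real \<Rightarrow> real \<Rightarrow> real" where
  "fluctuation_factor _ m \<beta> hbar s = (m / (2 * pi * \<beta> * hbar * s)) powr (real CARD('n) / 2)"

definition direct_heat_kernel ::
  "real \<Rightarrow> real \<Rightarrow> real \<Rightarrow> real ^ 'n \<Rightarrow> real ^ 'n \<Rightarrow> real" where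
  "direct_heat_kernel m \<beta> hbar XR XP =
     fluctuation_factor TYPE('n) m \<beta> hbar 1 * exp (- action m \<beta> hbar (direct_path XP XR))"

definition bounce_heat_kernel ::
  "real \<Rightarrow> real \<Rightarrow> real \<Rightarrow> real \<Rightarrow> real ^ 'n \<Rightarrow> real ^ 'n \<Rightarrow> real ^ 'n \<Rightarrow> real" where
  "bounce_heat_kernel m \<beta> hbar \<tau>\<^sub>1 XB XR XP =
     fluctuation_factor TYPE('n) m \<beta> hbar \<tau>\<^sub>1 * fluctuation_factor TYPE('n) m \<beta> hbar (1 - \<tau>\<^sub>1) *
     (LINT QB|lborel.
        exp (- action m \<beta> hbar (\<lambda>\<tau>. bounce_path \<tau>\<^sub>1 XP XB XR \<tau> + bounce_fluctuation \<tau>\<^sub>1 QB \<tau>)))"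

lemma frontier_half_space:
  fixes k :: "'n::finite"
  shows "frontier (half_space k) = {x. x $ k = 0}"
proof -
  have "frontier {x :: real ^ 'n. axis k 1 \<bullet> x \<ge> 0} = {x. axis k 1 \<bullet> x = 0}"
    by (rule frontier_halfspace_ge) (simp add: axis_eq_0_iff)
  then show ?thesis
    by (simp add: half_space_def inner_axis')
qed

lemma action_direct_path:
  "action m \<beta> hbar (direct_path XP XR) = m / (2 * \<beta> * hbar) * (norm (XR - XP))\<^sup>2"
proof -
  have "(direct_path XP XR has_vector_derivative XR - XP) (at \<tau>)" for \<tau>
    unfolding direct_path_def [abs_def]
    by (auto intro!: derivative_eq_intros simp: algebra_simps)
  then have "vector_derivative (direct_path XP XR) (at \<tau>) = XR - XP" for \<tau>
    by (rule vector_derivative_at)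
  then show ?thesis
    by (simp add: action_def)
qed

lemma action_bounce_path:
  fixes XP XB XR QB :: "real ^ 'n"
  assumes t: "0 < \<tau>\<^sub>1" "\<tau>\<^sub>1 < 1"
  shows "action m \<beta> hbar (\<lambda>\<tau>. bounce_path \<tau>\<^sub>1 XP XB XR \<tau> + bounce_fluctuation \<tau>\<^sub>1 QB \<tau>) =
    m / (2 * \<beta> * hbar) * (1 / \<tau>\<^sub>1 * (norm (XB - XP + QB))\<^sup>2 +
      1 / (1 - \<tau>\<^sub>1) * (norm (XR - XB - QB))\<^sup>2)"
proof -
  define X where "X = (\<lambda>\<tau>. bounce_path \<tau>\<^sub>1 XP XB XR \<tau> + bounce_fluctuation \<tau>\<^sub>1 QB \<tau>)"
  define u where "u = XB - XP + QB"
  define v where "v = XR - XB - QB"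
  have X1: "X \<tau> = XP + (\<tau> / \<tau>\<^sub>1) *\<^sub>R u" if "\<tau> \<le> \<tau>\<^sub>1" for \<tau>
    using that unfolding X_def u_def bounce_path_def bounce_fluctuation_def
    by (simp add: algebra_simps)
  have X2: "X \<tau> = XR + ((\<tau> - 1) / (1 - \<tau>\<^sub>1)) *\<^sub>R v" if "\<tau> > \<tau>\<^sub>1" for \<tau>
  proof -
    have eq': "(\<tau> - 1) / (1 - \<tau>\<^sub>1) = - ((1 - \<tau>) / (1 - \<tau>\<^sub>1))"
      using t by (simp add: field_simps)
    have eq: "(\<tau> - \<tau>\<^sub>1) / (1 - \<tau>\<^sub>1) = 1 - (1 - \<tau>) / (1 - \<tau>\<^sub>1)"
      using t by (simp add: field_simps)
    show ?thesis
      using that unfolding X_def v_def bounce_path_def bounce_fluctuation_def eq eq'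
      by (simp add: algebra_simps)
  qed
  have D1: "vector_derivative X (at \<tau>) = (1 / \<tau>\<^sub>1) *\<^sub>R u" if "\<tau> < \<tau>\<^sub>1" for \<tau>
  proof (rule vector_derivative_at)
    have "((\<lambda>\<tau>. XP + (\<tau> / \<tau>\<^sub>1) *\<^sub>R u) has_vector_derivative (1 / \<tau>\<^sub>1) *\<^sub>R u) (at \<tau>)"
      using t by (auto intro!: derivative_eq_intros)
    then show "(X has_vector_derivative (1 / \<tau>\<^sub>1) *\<^sub>R u) (at \<tau>)"
      by (rule has_vector_derivative_transform_within_open [where S = "{..<\<tau>\<^sub>1}"])
        (use that X1 in auto)
  qed
  have D2: "vector_derivative X (at \<tau>) = (1 / (1 - \<tau>\<^sub>1)) *\<^sub>R v" if "\<tau> > \<tau>\<^sub>1" for \<tau>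
  proof (rule vector_derivative_at)
    have "((\<lambda>\<tau>. XR + ((\<tau> - 1) / (1 - \<tau>\<^sub>1)) *\<^sub>R v) has_vector_derivative
        (1 / (1 - \<tau>\<^sub>1)) *\<^sub>R v) (at \<tau>)"
      using t by (auto intro!: derivative_eq_intros)
    then show "(X has_vector_derivative (1 / (1 - \<tau>\<^sub>1)) *\<^sub>R v) (at \<tau>)"
      by (rule has_vector_derivative_transform_within_open [where S = "{\<tau>\<^sub>1<..}"])
        (use that X2 in auto)
  qed
  let ?f = "\<lambda>\<tau>. (norm (vector_derivative X (at \<tau>)))\<^sup>2"
  have I1: "(?f has_integral (1 / \<tau>\<^sub>1 * (norm u)\<^sup>2)) {0..\<tau>\<^sub>1}"
  proof (rule has_integral_spike_finite [where S = "{\<tau>\<^sub>1}" and f = "\<lambda>_. (norm u / \<tau>\<^sub>1)\<^sup>2"])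
    show "((\<lambda>_. (norm u / \<tau>\<^sub>1)\<^sup>2) has_integral (1 / \<tau>\<^sub>1 * (norm u)\<^sup>2)) {0..\<tau>\<^sub>1}"
      using has_integral_const_real [of "(norm u / \<tau>\<^sub>1)\<^sup>2" 0 \<tau>\<^sub>1] t
      by (simp add: power2_eq_square)
  qed (use t D1 in auto)
  have I2: "(?f has_integral (1 / (1 - \<tau>\<^sub>1) * (norm v)\<^sup>2)) {\<tau>\<^sub>1..1}"
  proof (rule has_integral_spike_finite
      [where S = "{\<tau>\<^sub>1}" and f = "\<lambda>_. (norm v / (1 - \<tau>\<^sub>1))\<^sup>2"])
    show "((\<lambda>_. (norm v / (1 - \<tau>\<^sub>1))\<^sup>2) has_integral (1 / (1 - \<tau>\<^sub>1) * (norm v)\<^sup>2)) {\<tau>\<^sub>1..1}"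
      using has_integral_const_real [of "(norm v / (1 - \<tau>\<^sub>1))\<^sup>2" \<tau>\<^sub>1 1] t
      by (simp add: power2_eq_square)
  qed (use t D2 in auto)
  have "(?f has_integral (1 / \<tau>\<^sub>1 * (norm u)\<^sup>2 + 1 / (1 - \<tau>\<^sub>1) * (norm v)\<^sup>2)) {0..1}"
    by (rule has_integral_combine [OF _ _ I1 I2]) (use t in auto)
  then have "integral {0..1} ?f = 1 / \<tau>\<^sub>1 * (norm u)\<^sup>2 + 1 / (1 - \<tau>\<^sub>1) * (norm v)\<^sup>2"
    by (rule integral_unique)
  then show ?thesis
    unfolding action_def X_def [symmetric] u_def v_def by simp
qed

lemma direct_heat_kernel_eq:
  fixes XP XR :: "real ^ 'n"
  shows "direct_heat_kernel m \<beta> hbar XR XP =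
    (m / (2 * pi * \<beta> * hbar)) powr (real CARD('n) / 2) *
    exp (- (m / (2 * \<beta> * hbar)) * (norm (XR - XP))\<^sup>2)"
  by (simp add: direct_heat_kernel_def fluctuation_factor_def action_direct_path)

lemma bounce_heat_kernel_eq:
  fixes XP XB XR :: "real ^ 'n"
  assumes "m > 0" "\<beta> > 0" "hbar > 0" "0 < \<tau>\<^sub>1" "\<tau>\<^sub>1 < 1"
  shows "bounce_heat_kernel m \<beta> hbar \<tau>\<^sub>1 XB XR XP =
    (m / (2 * pi * \<beta> * hbar)) ^ CARD('n) * (1 / (\<tau>\<^sub>1 * (1 - \<tau>\<^sub>1))) powr (real CARD('n) / 2) *
    (LINT QB|lborel. exp (- (m / (2 * \<beta> * hbar)) *
       (1 / \<tau>\<^sub>1 * (norm (XB - XP + QB))\<^sup>2 + 1 / (1 - \<tau>\<^sub>1) * (norm (XR - XB - QB))\<^sup>2)))"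
proof -
  define c where "c = m / (2 * pi * \<beta> * hbar)"
  define h where "h = real CARD('n) / 2"
  have c: "c > 0"
    using assms by (simp add: c_def)
  have "fluctuation_factor TYPE('n) m \<beta> hbar \<tau>\<^sub>1 * fluctuation_factor TYPE('n) m \<beta> hbar (1 - \<tau>\<^sub>1) =
      (c * (1 / \<tau>\<^sub>1)) powr h * (c * (1 / (1 - \<tau>\<^sub>1))) powr h"
    by (simp add: fluctuation_factor_def c_def h_def)
  also have "\<dots> = (c powr h * c powr h) * ((1 / \<tau>\<^sub>1) powr h * (1 / (1 - \<tau>\<^sub>1)) powr h)"
    using assms c by (subst (1 2) powr_mult) (simp_all add: mult_ac)
  also have "(1 / \<tau>\<^sub>1) powr h * (1 / (1 - \<tau>\<^sub>1)) powr h = (1 / (\<tau>\<^sub>1 * (1 - \<tau>\<^sub>1))) powr h"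
    using assms by (subst powr_mult [symmetric]) simp_all
  also have "c powr h * c powr h = c ^ CARD('n)"
    using c by (simp add: powr_add [symmetric] h_def powr_realpow)
  finally show ?thesis
    using assms by (simp add: bounce_heat_kernel_def action_bounce_path c_def h_def)
qed

end

theory Submission
  imports Defs "HOL-Probability.Distributions"
begin

text \<open>
  Completing the square in the position at the bouncing time gives
  \<open>\<parallel>p\<parallel>\<^sup>2 / s + \<parallel>q\<parallel>\<^sup>2 / (1 - s) = \<parallel>p + q\<parallel>\<^sup>2 + \<parallel>(1 - s) p - s q\<parallel>\<^sup>2 / (s (1 - s))\<close>. With
  \<open>p = XB - XP + QB\<close> and \<open>q = XR - XB - QB\<close> the first term is the direct exponent, and the second is
  \<open>\<parallel>QB - w\<parallel>\<^sup>2 / (s (1 - s))\<close> for a vector \<open>w\<close> independent of \<open>QB\<close>. The remaining Gaussian integral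
  cancels the surplus prefactor.
\<close>

text \<open>The integrand is \<open>sqrt (pi / a)\<close> times a normal density, which has total
  mass 1. The nonnegative integral is the form needed for the product formula in several
  dimensions.\<close>

lemma nn_integral_gaussian:
  fixes a \<mu> :: real
  assumes "a > 0"
  shows "(\<integral>\<^sup>+x. ennreal (exp (- a * (x - \<mu>)\<^sup>2)) \<partial>lborel) = ennreal (sqrt (pi / a))"
proof -
  \<comment> \<open>The variance is fixed by matching exponents:
    \<open>1 / (2 * \<sigma>\<^sup>2) = a\<close>.\<close>
  define \<sigma> where "\<sigma> = 1 / sqrt (2 * a)"
  have \<sigma>: "\<sigma> > 0" and \<sigma>2: "\<sigma>\<^sup>2 = 1 / (2 * a)"
    using assms by (simp_all add: \<sigma>_def power_divide)
  have "exp (- a * (x - \<mu>)\<^sup>2) = sqrt (pi / a) * normal_density \<mu> \<sigma> x" for x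
    using assms unfolding normal_density_def \<sigma>2 by (simp add: real_sqrt_divide mult.commute)
  then have "(\<integral>\<^sup>+x. ennreal (exp (- a * (x - \<mu>)\<^sup>2)) \<partial>lborel) =
      (\<integral>\<^sup>+x. ennreal (sqrt (pi / a) * normal_density \<mu> \<sigma> x) \<partial>lborel)"
    by simp
  also have "\<dots> = ennreal (\<integral>x. sqrt (pi / a) * normal_density \<mu> \<sigma> x \<partial>lborel)"
    using assms \<sigma> by (intro nn_integral_eq_integral) auto
  also have "\<dots> = ennreal (sqrt (pi / a))"
    using \<sigma> by simp
  finally show ?thesis .
qed

text \<open>The squared norm is a sum over coordinates, so the exponential factors and the integral
  becomes a product of \<open>DIM('a)\<close> equal one-dimensional integrals.\<close>

lemma integral_gaussian_euclidean:
  fixes w :: "'a::euclidean_space"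
  assumes "a > 0"
  shows "(LINT x|lborel. exp (- a * (norm (x - w))\<^sup>2)) = sqrt (pi / a) ^ DIM('a)"
proof -
  have "(norm (x - w))\<^sup>2 = (\<Sum>b\<in>Basis. (x \<bullet> b - w \<bullet> b)\<^sup>2)" for x
    unfolding power2_norm_eq_inner by (subst euclidean_inner) (simp add: inner_diff_left power2_eq_square)
  then have "exp (- a * (norm (x - w))\<^sup>2) = (\<Prod>b\<in>Basis. exp (- a * (x \<bullet> b - w \<bullet> b)\<^sup>2))" for x
    by (simp add: exp_sum [symmetric] sum_distrib_left sum_negf)
  then have "(\<integral>\<^sup>+x. ennreal (exp (- a * (norm (x - w))\<^sup>2)) \<partial>lborel) =
      (\<integral>\<^sup>+x. (\<Prod>b\<in>Basis. ennreal (exp (- a * (x \<bullet> b - w \<bullet> b)\<^sup>2))) \<partial>lborel)"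
    by (simp add: prod_ennreal)
  also have "\<dots> = (\<Prod>b\<in>(Basis :: 'a set). ennreal (sqrt (pi / a)))"
    using assms by (subst nn_integral_lborel_prod) (simp_all only: nn_integral_gaussian, auto)
  also have "\<dots> = ennreal (sqrt (pi / a) ^ DIM('a))"
    using assms by (simp add: ennreal_power)
  finally show ?thesis
    using assms by (simp add: integral_eq_nn_integral)
qed

lemma weighted_norm_squares:
  fixes p q :: "'a::real_inner"
  assumes "0 < s" "s < 1"
  shows "1 / s * (norm p)\<^sup>2 + 1 / (1 - s) * (norm q)\<^sup>2 =
    (norm (p + q))\<^sup>2 + 1 / (s * (1 - s)) * (norm ((1 - s) *\<^sub>R p - s *\<^sub>R q))\<^sup>2"
proof -
  \<comment> \<open>With \<open>P\<close>, \<open>Q\<close>, \<open>R\<close> in the roles of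
    \<open>p \<bullet> p\<close>, \<open>q \<bullet> q\<close>, \<open>p \<bullet> q\<close>, the
    claim is a rational identity in scalars. The cross terms cancel, and
    \<open>1 / s = 1 + (1 - s) / s\<close> accounts for \<open>P\<close>, symmetrically for
    \<open>Q\<close>.\<close>
  have "1 / s * P + 1 / (1 - s) * Q = (P + 2 * R + Q) +
      1 / (s * (1 - s)) * ((1 - s)\<^sup>2 * P - 2 * (s * (1 - s)) * R + s\<^sup>2 * Q)" for P Q R :: real
    using assms by (simp add: divide_simps) algebra
  moreover have "(norm (p + q))\<^sup>2 = p \<bullet> p + 2 * (p \<bullet> q) + q \<bullet> q"
    by (simp add: power2_norm_eq_inner inner_simps inner_commute)
  moreover have "(norm ((1 - s) *\<^sub>R p - s *\<^sub>R q))\<^sup>2 =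
      (1 - s)\<^sup>2 * (p \<bullet> p) - 2 * (s * (1 - s)) * (p \<bullet> q) + s\<^sup>2 * (q \<bullet> q)"
    unfolding power2_norm_eq_inner inner_diff_left inner_diff_right inner_scaleR_left inner_scaleR_right
      inner_commute [of q p]
    by algebra
  ultimately show ?thesis
    by (simp only: power2_norm_eq_inner)
qed

theorem proposition3p1:
  fixes m \<beta> hbar \<tau>\<^sub>1 :: real
    and k :: "'n::finite"
    and XP XR XB :: "real ^ 'n"
  assumes "m > 0" and "\<beta> > 0" and "hbar > 0"
    and "0 < \<tau>\<^sub>1" and "\<tau>\<^sub>1 < 1"
    and "XP \<in> half_space k" and "XR \<in> half_space k"
    and "XB \<in> frontier (half_space k)"
  shows "direct_heat_kernel m \<beta> hbar XR XP = bounce_heat_kernel m \<beta> hbar \<tau>\<^sub>1 XB XR XP"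
proof -
  define a where "a = m / (2 * \<beta> * hbar)"
  define c where "c = m / (2 * pi * \<beta> * hbar)"
  define r where "r = \<tau>\<^sub>1 * (1 - \<tau>\<^sub>1)"
  \<comment> \<open>The shift for which \<open>XB + w\<close> is the position of the direct path at
    time \<open>\<tau>\<^sub>1\<close>; it minimizes the bouncing action over
    \<open>QB\<close>.\<close>
  define w where "w = \<tau>\<^sub>1 *\<^sub>R (XR - XB) - (1 - \<tau>\<^sub>1) *\<^sub>R (XB - XP)"
  define E where "E = exp (- a * (norm (XR - XP))\<^sup>2)"
  have pos: "a > 0" "c > 0" "r > 0"
    using assms by (simp_all add: a_def c_def r_def)
  \<comment> \<open>This removes \<open>pi\<close> from the Gaussian value:
    \<open>pi / (a / r) = r / c\<close>.\<close>
  have a_eq: "a = pi * c"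
    by (simp add: a_def c_def)
  have "exp (- a * (1 / \<tau>\<^sub>1 * (norm (XB - XP + QB))\<^sup>2 + 1 / (1 - \<tau>\<^sub>1) * (norm (XR - XB - QB))\<^sup>2)) =
      E * exp (- (a / r) * (norm (QB - w))\<^sup>2)" for QB
  proof -
    have "(1 - \<tau>\<^sub>1) *\<^sub>R (XB - XP + QB) - \<tau>\<^sub>1 *\<^sub>R (XR - XB - QB) = QB - w"
      by (simp add: w_def algebra_simps)
    moreover have "(XB - XP + QB) + (XR - XB - QB) = XR - XP"
      by simp
    ultimately have "1 / \<tau>\<^sub>1 * (norm (XB - XP + QB))\<^sup>2 + 1 / (1 - \<tau>\<^sub>1) * (norm (XR - XB - QB))\<^sup>2 =
        (norm (XR - XP))\<^sup>2 + 1 / r * (norm (QB - w))\<^sup>2"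
      using assms by (simp only: weighted_norm_squares r_def)
    then show ?thesis
      by (simp add: E_def exp_add [symmetric] distrib_left)
  qed
  then have "(LINT QB|lborel. exp (- a *
        (1 / \<tau>\<^sub>1 * (norm (XB - XP + QB))\<^sup>2 + 1 / (1 - \<tau>\<^sub>1) * (norm (XR - XB - QB))\<^sup>2))) =
      E * sqrt (r / c) ^ CARD('n)"
    using pos integral_gaussian_euclidean [of "a / r" w] by (simp add: a_eq)
  then have "bounce_heat_kernel m \<beta> hbar \<tau>\<^sub>1 XB XR XP =
      c ^ CARD('n) * (1 / r) powr (real CARD('n) / 2) * (E * sqrt (r / c) ^ CARD('n))"
    using assms by (simp add: bounce_heat_kernel_eq a_def c_def r_def)
  \<comment> \<open>Real powers become natural powers of square roots, so that all prefactors share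
    the exponent \<open>CARD('n)\<close>.\<close>
  moreover have half: "x powr (real CARD('n) / 2) = sqrt x ^ CARD('n)" if "x > 0" for x :: real
    using that by (simp add: powr_half_sqrt_powr powr_realpow real_sqrt_power)
  \<comment> \<open>Per dimension, \<open>r\<close> cancels and
    \<open>c * sqrt (1 / c) = sqrt c\<close> remains, the direct prefactor.\<close>
  moreover have "c ^ CARD('n) * sqrt (1 / r) ^ CARD('n) * sqrt (r / c) ^ CARD('n) = sqrt c ^ CARD('n)"
    unfolding power_mult_distrib [symmetric]
    using pos by (simp add: real_sqrt_divide real_div_sqrt)
  moreover have "direct_heat_kernel m \<beta> hbar XR XP = c powr (real CARD('n) / 2) * E"
    by (simp add: direct_heat_kernel_eq a_def c_def E_def)
  ultimately show ?thesis
    using pos by (simp add: mult_ac)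
qed

end
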